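(* Let $X$ be a non-negative random variable with CDF $F$ which is DHRA, i.e. $F^{-1}\circ\mathcal{E}$ is star-shaped, where $\mathcal{E}(x)=1-e^{-x}$: the map $x\mapsto F^{-1}(1-e^{-x})/x$ is increasing on $(0,\infty)$. Let $1\le i\le n$ and $1\le j\le m$ be integers and define, for $x\ge 0$, $$Z(x)=\binom{n}{i}\, i\sum_{k=0}^{i-1}\binom{i-1}{k}(-1)^{i-1-k}\frac{(e^{-x})^{n-k}(-kx+nx+1)}{(k-n)^2}-\binom{m}{j}\, j\sum_{k=0}^{j-1}\binom{j-1}{k}(-1)^{j-1-k}\frac{(e^{-x})^{m-k}(-kx+mx+1)}{(k-m)^2}.$$ Let $R$ be the set of solutions $x\in(0,1)$ of the equation $$x^{\,i-j}(1-x)^{(n-i)-(m-j)}=\frac{\mathcal{B}(i,n-i+1)}{\mathcal{B}(j,m-j+1)},$$ where $\mathcal{B}$ is the beta function. If $Z(-\log(1-r))\geq 0$ for every $r\in R$, then $X_{i:n}\geq_{ss}X_{j:m}$.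
   Context: $F^{-1}(p)=\inf\{x:F(x)\ge p\}$. $X_{k:N}$ is the $k$-th order statistic of an i.i.d. sample of size $N$ from $F$. A function $u:[0,\infty)\to[0,\infty)$ with $u(0)=0$ is star-shaped if $u(x)/x$ is increasing on $(0,\infty)$. For non-negative random variables $V,W$, $V\geq_{ss}W$ means $\mathbb{E}\,u(V)\geq\mathbb{E}\,u(W)$ for every star-shaped $u$ for which the expectations exist. "Increasing" means non-decreasing. *)

theory Defs
  imports "HOL-Probability.Probability"
begin

definition quantile :: "(real \<Rightarrow> real) \<Rightarrow> real \<Rightarrow> real" where
  "quantile F p = Inf {x. p \<le> F x}"

definition star_shaped_fun :: "(real \<Rightarrow> real) \<Rightarrow> bool" where
  "star_shaped_fun u \<longleftrightarrow> u 0 = 0 \<and> (\<forall>x\<ge>0. 0 \<le> u x) \<and>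
     (\<forall>x y. 0 < x \<and> x \<le> y \<longrightarrow> u x / x \<le> u y / y)"

definition order_stat :: "real measure \<Rightarrow> nat \<Rightarrow> nat \<Rightarrow> real measure" where
  "order_stat M k N = distr (PiM {..<N} (\<lambda>_. M)) borel
      (\<lambda>\<omega>. sort (map \<omega> [0..<N]) ! (k - 1))"

definition ss_ge :: "real measure \<Rightarrow> real measure \<Rightarrow> bool" where
  "ss_ge V W \<longleftrightarrow> (\<forall>u. star_shaped_fun u \<and> integrable V u \<and> integrable W u \<longrightarrow>
      (\<integral>x. u x \<partial>W) \<le> (\<integral>x. u x \<partial>V))"

definition Zfun :: "nat \<Rightarrow> nat \<Rightarrow> nat \<Rightarrow> nat \<Rightarrow> real \<Rightarrow> real" where
  "Zfun i n j m x =
     real (n choose i) * real i * (\<Sum>k=0..i-1. real ((i-1) choose k) * (-1) ^ (i-1-k) *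
        (exp (-x) ^ (n-k) * (- real k * x + real n * x + 1)) / (real k - real n)^2)
   - real (m choose j) * real j * (\<Sum>k=0..j-1. real ((j-1) choose k) * (-1) ^ (j-1-k) *
        (exp (-x) ^ (m-k) * (- real k * x + real m * x + 1)) / (real k - real m)^2)"

end

theory Submission
  imports Defs "HOL-Real_Asymp.Real_Asymp"
begin

text \<open>
  Let \<open>f\<^sub>i\<close>, \<open>f\<^sub>j\<close> be the densities of the order statistics \<open>i:n\<close> and \<open>j:m\<close> of standard
  exponential samples. Then \<open>Z(x)\<close> is the integral of \<open>t (f\<^sub>i(t) - f\<^sub>j(t))\<close> over \<open>(x, \<infinity>)\<close>, so that
  \<open>R\<close> is, under \<open>r = 1 - exp (-x)\<close>, the set of critical points of \<open>Z\<close> on \<open>(0, \<infinity>)\<close>.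

  Write \<open>D = f\<^sub>i - f\<^sub>j\<close>. If \<open>i < j\<close>, then \<open>D > 0\<close> near \<open>0\<close>, so \<open>Z\<close> decreases at first, and since
  \<open>Z \<rightarrow> 0\<close> at infinity, a negative value would force a negative interior minimum. If \<open>i \<ge> j\<close> and
  \<open>n - i \<le> m - j\<close>, then \<open>f\<^sub>i / f\<^sub>j\<close> is increasing and \<open>Z \<ge> 0\<close> by stochastic dominance. Otherwise
  \<open>D < 0\<close> eventually, so \<open>Z < 0\<close> at the last zero of \<open>D\<close>, which the hypothesis excludes.
  Hence \<open>Z \<ge> 0\<close> throughout.

  Since \<open>X\<^sub>i\<^sub>:\<^sub>n\<close> has the law of \<open>Q = F\<^sup>-\<^sup>1 \<circ> \<E>\<close> applied to the exponential order statistic, the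
  expectation of \<open>u(X\<^sub>i\<^sub>:\<^sub>n)\<close> is the integral of \<open>h(t) t f\<^sub>i(t)\<close> with \<open>h(t) = u(Q(t)) / t\<close>. By DHRA and
  star-shapedness of \<open>u\<close>, \<open>h\<close> is increasing, hence a mixture of indicators of upper half-lines,
  on which \<open>Z \<ge> 0\<close> is the desired comparison.
\<close>

subsection \<open>Binomial tails and exponential order statistics\<close>

text \<open>For \<open>1 \<le> i \<le> n\<close> and \<open>p\<close> in [0,1] this is the
  regularized incomplete beta function with parameters \<open>i\<close> and
  \<open>n - i + 1\<close>; at \<open>p = F x\<close> it is the CDF of the order statistic at
  \<open>x\<close>.\<close>

definition binomial_tail :: "nat \<Rightarrow> nat \<Rightarrow> real \<Rightarrow> real" where
  "binomial_tail i n p = (\<Sum>k=i..n. real (n choose k) * p ^ k * (1 - p) ^ (n - k))"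

lemma binomial_tail_0: "1 \<le> i \<Longrightarrow> binomial_tail i n 0 = 0"
  by (auto simp: binomial_tail_def intro!: sum.neutral)

lemma binomial_tail_1:
  assumes "i \<le> n"
  shows "binomial_tail i n 1 = 1"
proof -
  have "binomial_tail i n 1 = (\<Sum>k=i..n. if k = n then 1 else 0)"
    unfolding binomial_tail_def by (intro sum.cong) auto
  then show ?thesis using assms by simp
qed

text \<open>Differentiating term by term gives a telescoping sum. Descending induction from
  \<open>i = n\<close> makes this precise: by \<open>absorb\<close>, the second half of the new
  term's derivative cancels the derivative of the remaining tail.\<close>

lemma has_field_derivative_binomial_tail:
  assumes "1 \<le> i" "i \<le> n"
  shows "(binomial_tail i n has_field_derivative
           real i * real (n choose i) * p ^ (i - 1) * (1 - p) ^ (n - i)) (at p)"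
  using assms(2,1)
proof (induction i rule: inc_induct)
  case base
  have eq: "binomial_tail n n = (\<lambda>p. p ^ n)"
    by (simp add: binomial_tail_def fun_eq_iff)
  show ?case unfolding eq by (auto intro!: derivative_eq_intros)
next
  case (step i)
  have eq: "binomial_tail i n = (\<lambda>p. real (n choose i) * p ^ i * (1 - p) ^ (n - i) + binomial_tail (Suc i) n p)"
    using step by (simp add: binomial_tail_def fun_eq_iff sum.atLeast_Suc_atMost)
  have IH: "(binomial_tail (Suc i) n has_field_derivative
      real (Suc i) * real (n choose Suc i) * p ^ i * (1 - p) ^ (n - Suc i)) (at p)"
    using step by simp
  have absorb: "real (Suc i) * real (n choose Suc i) = real (n - i) * real (n choose i)"
    using binomial_absorb_comp[of n i] binomial_absorption[of i n]
    by (metis of_nat_mult)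
  have "((\<lambda>p. real (n choose i) * p ^ i * (1 - p) ^ (n - i) + binomial_tail (Suc i) n p)
      has_field_derivative
      (real (n choose i) * (real i * p ^ (i - 1)) * (1 - p) ^ (n - i)
       - real (n choose i) * p ^ i * (real (n - i) * (1 - p) ^ (n - Suc i)))
       + real (Suc i) * real (n choose Suc i) * p ^ i * (1 - p) ^ (n - Suc i)) (at p)"
    by (rule derivative_eq_intros refl IH | simp)+
  then show ?case unfolding eq absorb by (simp add: algebra_simps)
qed

text \<open>The formula is a density only on the positive half-line; for \<open>t < 0\<close> it can
  be negative, so the measures built from it carry an indicator.\<close>

definition exp_os_density :: "nat \<Rightarrow> nat \<Rightarrow> real \<Rightarrow> real" where
  "exp_os_density i n t =
     real i * real (n choose i) * (1 - exp (-t)) ^ (i - 1) * exp (-t) ^ (n - i + 1)"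

lemma exp_os_density_nonneg: "0 \<le> t \<Longrightarrow> 0 \<le> exp_os_density i n t"
  by (simp add: exp_os_density_def)

lemma continuous_exp_os_density: "continuous_on A (exp_os_density i n)"
  unfolding exp_os_density_def by (intro continuous_intros)

lemma measurable_exp_os_density[measurable]: "exp_os_density i n \<in> borel_measurable borel"
  by (intro borel_measurable_continuous_onI continuous_exp_os_density)

lemma has_field_derivative_exp_os_cdf:
  assumes "1 \<le> i" "i \<le> n"
  shows "((\<lambda>t. binomial_tail i n (1 - exp (-t))) has_field_derivative exp_os_density i n t) (at t)"
proof -
  have "((\<lambda>t. binomial_tail i n (1 - exp (-t))) has_field_derivative
     (real i * real (n choose i) * (1 - exp (-t)) ^ (i - 1) * (1 - (1 - exp (-t))) ^ (n - i)) * exp (-t)) (at t)"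
    by (rule DERIV_chain2[OF has_field_derivative_binomial_tail[OF assms]])
       (auto intro!: derivative_eq_intros)
  then show ?thesis by (simp add: exp_os_density_def algebra_simps)
qed

lemma tendsto_exp_os_cdf:
  assumes "1 \<le> i" "i \<le> n"
  shows "((\<lambda>t. binomial_tail i n (1 - exp (-t))) \<longlongrightarrow> 1) at_top"
proof -
  have "isCont (binomial_tail i n) 1"
    using has_field_derivative_binomial_tail[OF assms] by (rule DERIV_isCont)
  moreover have "((\<lambda>t::real. 1 - exp (-t)) \<longlongrightarrow> 1) at_top"
    by real_asymp
  ultimately show ?thesis
    using isCont_tendsto_compose binomial_tail_1[OF assms(2)] by metis
qed

section \<open>Truncated first moments of exponential order statistics\<close>

text \<open>This is one half of \<open>Zfun\<close>: the integral of
  \<open>t * exp_os_density i n t\<close> over \<open>t > x\<close>, after expanding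
  \<open>(1 - exp (-t)) ^ (i - 1)\<close> by the binomial theorem and integrating each exponential
  by parts.\<close>

definition exp_os_moment :: "nat \<Rightarrow> nat \<Rightarrow> real \<Rightarrow> real" where
  "exp_os_moment i n x = real (n choose i) * real i *
     (\<Sum>k=0..i-1. real ((i-1) choose k) * (-1) ^ (i-1-k) *
        (exp (-x) ^ (n-k) * (- real k * x + real n * x + 1)) / (real k - real n)^2)"

lemma Zfun_eq: "Zfun i n j m x = exp_os_moment i n x - exp_os_moment j m x"
  by (simp add: Zfun_def exp_os_moment_def)

lemma exp_os_moment_summand:
  assumes "k < n"
  shows "exp (-x) ^ (n-k) * (- real k * x + real n * x + 1) / (real k - real n)^2
    = exp (- real (n - k) * x) * (real (n - k) * x + 1) / (real (n - k))^2"
proof -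
  have "exp (-x) ^ (n-k) = exp (- real (n - k) * x)"
    by (simp flip: exp_of_nat_mult)
  moreover have "(real k - real n)^2 = (real (n - k))^2"
    using assms by (simp add: of_nat_diff power2_commute)
  moreover have "- real k * x + real n * x + 1 = real (n - k) * x + 1"
    using assms by (simp add: of_nat_diff algebra_simps)
  ultimately show ?thesis by simp
qed

lemma exp_os_moment_altdef:
  assumes "1 \<le> i" "i \<le> n"
  shows "exp_os_moment i n x = real (n choose i) * real i *
     (\<Sum>k=0..i-1. real ((i-1) choose k) * (-1) ^ (i-1-k) *
        (exp (- real (n - k) * x) * (real (n - k) * x + 1) / (real (n - k))^2))"
proof -
  have "k < n" if "k \<in> {0..i-1}" for k using that assms by auto
  then show ?thesis
    unfolding exp_os_moment_def
    by (intro arg_cong2[where f="(*)"] refl sum.cong)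
      (subst exp_os_moment_summand[symmetric], auto)
qed

text \<open>With \<open>a = n - k > 0\<close>, each summand is an antiderivative of
  \<open>- x * exp (- a * x)\<close>; the binomial theorem then resums the derivatives to the
  density.\<close>

lemma has_field_derivative_exp_os_moment:
  assumes "1 \<le> i" "i \<le> n"
  shows "(exp_os_moment i n has_field_derivative - (x * exp_os_density i n x)) (at x)"
proof -
  have d: "((\<lambda>x. exp (- a * x) * (a * x + 1) / a^2) has_field_derivative - (x * exp (- a * x))) (at x)"
    if "a > 0" for a x :: real
    using that by (auto intro!: derivative_eq_intros simp: field_simps power2_eq_square)
  have "((\<lambda>x. exp_os_moment i n x) has_field_derivative
     real (n choose i) * real i * (\<Sum>k=0..i-1. real ((i-1) choose k) * (-1) ^ (i-1-k) *
        (- (x * exp (- real (n - k) * x))))) (at x)"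
    unfolding exp_os_moment_altdef[OF assms]
    using assms by (intro DERIV_cmult DERIV_sum d) auto
  moreover have "(\<Sum>k=0..i-1. real ((i-1) choose k) * (-1) ^ (i-1-k) * (- (x * exp (- real (n - k) * x))))
     = - x * exp (-x) ^ (n - i + 1) * (1 - exp (-x)) ^ (i - 1)"
  proof -
    \<comment> \<open>Pulling out the common power \<open>n - i + 1\<close> leaves the exponent
      \<open>i - 1 - k\<close>, which is also that of the sign, so both merge into a power of
      \<open>- exp (-x)\<close>.\<close>
    have e: "exp (- real (n - k) * x) = exp (-x) ^ (n - i + 1) * exp (-x) ^ (i - 1 - k)"
      if "k \<le> i - 1" for k
    proof -
      have "n - k = (n - i + 1) + (i - 1 - k)" using that assms by auto
      then have "exp (-x) ^ (n - k) = exp (-x) ^ (n - i + 1) * exp (-x) ^ (i - 1 - k)"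
        by (metis power_add)
      then show ?thesis by (simp flip: exp_of_nat_mult)
    qed
    have "(\<Sum>k=0..i-1. real ((i-1) choose k) * (-1) ^ (i-1-k) * (- (x * exp (- real (n - k) * x))))
      = (\<Sum>k=0..i-1. - x * exp (-x) ^ (n - i + 1) * (real ((i-1) choose k) * 1 ^ k * (- exp (-x)) ^ (i-1-k)))"
      by (intro sum.cong refl, subst e) (auto simp: power_minus[of "exp _"])
    also have "\<dots> = - x * exp (-x) ^ (n - i + 1) * (1 + (- exp (-x))) ^ (i - 1)"
      by (subst binomial_ring) (simp add: sum_distrib_left atLeast0AtMost)
    finally show ?thesis by simp
  qed
  ultimately show ?thesis by (simp add: exp_os_density_def algebra_simps)
qed

lemma tendsto_exp_os_moment:
  assumes "1 \<le> i" "i \<le> n"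
  shows "(exp_os_moment i n \<longlongrightarrow> 0) at_top"
proof -
  have lim: "((\<lambda>x. exp (- a * x) * (a * x + 1) / a^2) \<longlongrightarrow> 0) at_top" if "a > 0" for a :: real
    using that by real_asymp
  have "((\<lambda>x. exp_os_moment i n x) \<longlongrightarrow> real (n choose i) * real i *
     (\<Sum>k=0..i-1. real ((i-1) choose k) * (-1) ^ (i-1-k) * 0)) at_top"
    unfolding exp_os_moment_altdef[OF assms]
    using assms by (intro tendsto_mult tendsto_const tendsto_sum lim) auto
  then show ?thesis by simp
qed

subsection \<open>The sign of Z\<close>

lemma Beta_order_stat:
  assumes "1 \<le> i" "i \<le> n"
  shows "Beta (real i) (real n - real i + 1) = 1 / (real i * real (n choose i))"
proof -
  obtain k where k: "i = Suc k" using assms by (cases i) auto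
  have 1: "Gamma (real i) = fact k" using Gamma_fact[of k, where 'a=real] by (simp add: k add.commute)
  have 2: "Gamma (real n - real i + 1) = fact (n - i)"
    using Gamma_fact[of "n - i", where 'a=real] assms by (simp add: of_nat_diff add.commute)
  have 3: "Gamma (real i + (real n - real i + 1)) = fact n"
    using Gamma_fact[of n, where 'a=real] by (simp add: add.commute)
  have 4: "real (n choose i) = fact n / (real i * fact k * fact (n - i))"
    using assms by (simp add: binomial_fact k)
  show ?thesis unfolding Beta_def 1 2 3 4 using assms by simp
qed

text \<open>Divide the two densities: the extra factor \<open>exp (-x) = 1 - r\<close> of each
  cancels, and by \<open>Beta_order_stat\<close> the quotient of beta values is the inverse quotient
  of the normalizing constants. Real powers appear because the exponents may be negative.\<close>

lemma exp_os_density_eq_imp_root: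
  assumes "1 \<le> i" "i \<le> n" "1 \<le> j" "j \<le> m" "0 < x"
    and eq: "exp_os_density i n x = exp_os_density j m x"
  defines "r \<equiv> 1 - exp (-x)"
  shows "r powr (real i - real j) * (1 - r) powr ((real n - real i) - (real m - real j))
             = Beta (real i) (real n - real i + 1) / Beta (real j) (real m - real j + 1)"
proof -
  have r: "0 < r" "r < 1" using assms by (auto simp: r_def)
  have p: "exp_os_density k l x = real k * real (l choose k) * r powr (real k - 1) * (1 - r) powr (real l - real k + 1)"
    if "1 \<le> k" "k \<le> l" for k l
  proof -
    have a: "r powr (real k - 1) = r ^ (k - 1)"
      using that r powr_realpow[of r "k - 1"] by (simp add: of_nat_diff)
    have b: "(1 - r) powr (real l - real k + 1) = (1 - r) ^ (l - k + 1)"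
      using that r powr_realpow[of "1 - r" "l - k + 1"] by (simp add: of_nat_diff add.commute)
    show ?thesis unfolding a b by (simp add: r_def exp_os_density_def)
  qed
  define c d where "c = real i * real (n choose i)" and "d = real j * real (m choose j)"
  have cd: "0 < c" "0 < d" using assms by (auto simp: c_def d_def)
  have "r powr (real i - real j) * (1 - r) powr ((real n - real i) - (real m - real j))
     = (r powr (real i - 1) * (1 - r) powr (real n - real i + 1)) / (r powr (real j - 1) * (1 - r) powr (real m - real j + 1))"
    using powr_diff[of r "real i - 1" "real j - 1"]
      powr_diff[of "1 - r" "real n - real i + 1" "real m - real j + 1"] by simp
  also have "\<dots> = d / c"
    using eq r cd unfolding p[OF assms(1,2)] p[OF assms(3,4)] c_def[symmetric] d_def[symmetric]
    by (simp add: field_simps)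
  finally show ?thesis
    unfolding Beta_order_stat[OF assms(1,2)] Beta_order_stat[OF assms(3,4)] c_def d_def by simp
qed

lemma exp_os_cdf_diff:
  assumes "1 \<le> i" "i \<le> n" "1 \<le> j" "j \<le> m"
  defines "H \<equiv> \<lambda>x. binomial_tail i n (1 - exp (-x)) - binomial_tail j m (1 - exp (-x))"
  shows "H 0 = 0" "(H \<longlongrightarrow> 0) at_top"
    "(H has_field_derivative exp_os_density i n x - exp_os_density j m x) (at x)"
  using assms(1-4) tendsto_diff[OF tendsto_exp_os_cdf[of i n] tendsto_exp_os_cdf[of j m]]
  by (auto simp: H_def binomial_tail_0 intro!: DERIV_diff has_field_derivative_exp_os_cdf)

lemma Zfun_asymp:
  assumes "1 \<le> i" "i \<le> n" "1 \<le> j" "j \<le> m"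
  shows "(Zfun i n j m \<longlongrightarrow> 0) at_top"
    "(Zfun i n j m has_field_derivative
        - (x * (exp_os_density i n x - exp_os_density j m x))) (at x)"
proof -
  have eq: "Zfun i n j m = (\<lambda>x. exp_os_moment i n x - exp_os_moment j m x)"
    by (simp add: Zfun_eq fun_eq_iff)
  show "(Zfun i n j m \<longlongrightarrow> 0) at_top"
    using tendsto_diff[OF tendsto_exp_os_moment[of i n] tendsto_exp_os_moment[of j m]] assms
    by (simp add: eq)
  show "(Zfun i n j m has_field_derivative
        - (x * (exp_os_density i n x - exp_os_density j m x))) (at x)"
    using DERIV_diff[OF has_field_derivative_exp_os_moment[of i n x] has_field_derivative_exp_os_moment[of j m x]] assms
    by (simp add: eq algebra_simps)
qed

text \<open>The total integral of \<open>D\<close> over the positive half-line is 0. Were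
  \<open>D\<close> negative throughout, \<open>H\<close> would drop below 0 by time 1 and never
  climb back to its limit.\<close>

lemma exists_nonneg_of_vanishing_integral:
  fixes H D :: "real \<Rightarrow> real"
  assumes "H 0 = 0" "(H \<longlongrightarrow> 0) at_top" and dH: "\<And>x. (H has_field_derivative D x) (at x)"
  shows "\<exists>x>0. 0 \<le> D x"
proof (rule ccontr)
  assume "\<not> ?thesis"
  then have neg: "D x < 0" if "x > 0" for x using that by force
  \<comment> \<open>The open-interval version of the rule is used because the sign of
    \<open>D 0\<close> is unknown.\<close>
  have "H 1 < H 0"
    by (rule DERIV_neg_imp_decreasing_open) 
       (use neg dH in \<open>auto intro!: DERIV_continuous_on[of _ H D] intro: has_field_derivative_at_within\<close>)
  moreover have "H x \<le> H 1" if "x \<ge> 1" for x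
    by (rule DERIV_nonpos_imp_nonincreasing[OF that]) (use neg dH in \<open>force intro: less_imp_le\<close>)
  then have "0 \<le> H 1"
    by (intro tendsto_upperbound[OF assms(2)]) (auto intro: eventually_at_top_linorderI)
  ultimately show False using assms by simp
qed

text \<open>If \<open>D\<close> changes sign at \<open>c\<close>, then \<open>Z + c H\<close> has derivative \<open>(c - x) D \<le> 0\<close>
  and limit \<open>0\<close>, while \<open>H \<le> 0\<close>.\<close>

lemma nonneg_of_single_crossing:
  fixes H D Z :: "real \<Rightarrow> real"
  assumes H0: "H 0 = 0" and H1: "(H \<longlongrightarrow> 0) at_top" and dH: "\<And>x. (H has_field_derivative D x) (at x)"
    and Z1: "(Z \<longlongrightarrow> 0) at_top" and dZ: "\<And>x. (Z has_field_derivative - (x * D x)) (at x)"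
    and up: "\<And>x y. 0 < x \<Longrightarrow> x \<le> y \<Longrightarrow> 0 \<le> D x \<Longrightarrow> 0 \<le> D y"
    and "0 < a"
  shows "0 \<le> Z a"
proof -
  define S where "S = {x. 0 < x \<and> 0 \<le> D x}"
  define c where "c = Inf S"
  have S: "S \<noteq> {}" "bdd_below S"
    using exists_nonneg_of_vanishing_integral[OF H0 H1 dH] by (auto simp: S_def intro!: bdd_belowI[of _ 0])
  have c: "0 \<le> c" unfolding c_def using S by (intro cInf_greatest) (auto simp: S_def)
  have below: "D x \<le> 0" if "0 < x" "x < c" for x
  proof -
    have "x \<notin> S" using that cInf_lower[OF _ S(2), of x] by (auto simp: c_def)
    then show ?thesis using that by (auto simp: S_def)
  qed
  have above: "0 \<le> D x" if c_lt: "c < x" for x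
  proof -
    obtain y where "y \<in> S" "y < x" using cInf_lessD[OF S(1), of x] c_lt by (auto simp: c_def)
    then show ?thesis using up[of y x] by (auto simp: S_def)
  qed
  have contH: "continuous_on A H" for A
    using dH by (intro DERIV_continuous_on[of _ H D]) (auto intro: has_field_derivative_at_within)
  \<comment> \<open>Up to \<open>c\<close> the function \<open>H\<close> descends from
    \<open>H 0 = 0\<close>; beyond \<open>c\<close> it ascends to its limit 0.\<close>
  have "H a \<le> 0"
  proof (cases "a \<le> c")
    case True
    have "H a \<le> H 0"
      by (rule DERIV_nonpos_imp_decreasing_open[OF less_imp_le[OF \<open>0 < a\<close>]])
         (use below dH True contH in \<open>auto intro!: exI\<close>)
    then show ?thesis using H0 by simp
  next
    case False
    have "H a \<le> H x" if "a \<le> x" for x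
      by (rule DERIV_nonneg_imp_nondecreasing[OF that]) (use above dH False in force)
    then show ?thesis
      by (intro tendsto_lowerbound[OF H1]) (auto intro: eventually_at_top_linorderI)
  qed
  define K where "K = (\<lambda>x. Z x + c * H x)"
  have dK: "(K has_field_derivative (c - x) * D x) (at x)" for x
    unfolding K_def by (rule derivative_eq_intros dZ dH refl | simp add: algebra_simps)+
  have neg: "(c - x) * D x \<le> 0" if "0 < x" for x
    using above[of x] below[of x] that
    by (cases x c rule: linorder_cases) (auto simp: mult_le_0_iff)
  have "K x \<le> K a" if "a \<le> x" for x
    by (rule DERIV_nonpos_imp_nonincreasing[OF that]) (use dK neg \<open>0 < a\<close> in force)
  moreover have "(K \<longlongrightarrow> 0 + c * 0) at_top"
    unfolding K_def by (intro tendsto_intros Z1 H1)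
  ultimately have "0 \<le> K a"
    by (intro tendsto_upperbound[of K 0 at_top]) (auto intro: eventually_at_top_linorderI)
  moreover have "c * H a \<le> 0" using c \<open>H a \<le> 0\<close> by (simp add: mult_nonneg_nonpos)
  ultimately show ?thesis by (simp add: K_def)
qed

text \<open>A negative minimum of \<open>Z\<close> would be attained at an interior critical point.\<close>

lemma nonneg_of_nonneg_at_critical_points:
  fixes D Z :: "real \<Rightarrow> real"
  assumes Z1: "(Z \<longlongrightarrow> 0) at_top" and dZ: "\<And>x. (Z has_field_derivative - (x * D x)) (at x)"
    and crit: "\<And>x. 0 < x \<Longrightarrow> D x = 0 \<Longrightarrow> 0 \<le> Z x"
    and "0 < e" and pos: "\<And>x. 0 < x \<Longrightarrow> x \<le> e \<Longrightarrow> 0 < D x"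
    and "0 < a"
  shows "0 \<le> Z a"
proof (rule ccontr)
  assume "\<not> 0 \<le> Z a"
  have dec: "Z y < Z x" if "0 < x" "x < y" "y \<le> e" for x y
    by (rule DERIV_neg_imp_decreasing[OF that(2)]) (use dZ pos that in force)
  \<comment> \<open>As \<open>Z\<close> decreases on \<open>(0, e]\<close>, moving from
    \<open>a\<close> to \<open>b\<close> does not raise \<open>Z\<close>, and \<open>b\<close> lies
    beyond the initial decrease.\<close>
  define b where "b = max a e"
  have "Z b \<le> Z a" using dec[of a e] \<open>0 < a\<close> by (cases a e rule: linorder_cases) (auto simp: b_def)
  then have "Z b < 0" using \<open>\<not> 0 \<le> Z a\<close> by simp
  then have "eventually (\<lambda>x. Z b < Z x \<and> b < x) at_top"
    by (intro eventually_conj order_tendstoD(1)[OF Z1] eventually_gt_at_top)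
  then obtain N where N: "Z b < Z N" "b < N"
    using eventually_happens trivial_limit_at_top_linorder by blast
  have "0 < b" "e \<le> b" using \<open>0 < e\<close> by (auto simp: b_def)
  \<comment> \<open>The minimum over this interval is interior: \<open>Z\<close> strictly decreases
    from \<open>e/2\<close> to \<open>e\<close>, and \<open>Z N\<close> exceeds
    \<open>Z b\<close>.\<close>
  have "continuous_on {e/2..N} Z"
    using dZ by (intro DERIV_continuous_on[of _ Z "\<lambda>x. - (x * D x)"]) (auto intro: has_field_derivative_at_within)
  then obtain x where x: "x \<in> {e/2..N}" "\<And>y. y \<in> {e/2..N} \<Longrightarrow> Z x \<le> Z y"
    using continuous_attains_inf[of "{e/2..N}" Z] N \<open>e \<le> b\<close> \<open>0 < e\<close> by auto
  have "Z x \<le> Z b" using x(2)[of b] N \<open>e \<le> b\<close> \<open>0 < e\<close> by simp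
  have "x \<noteq> N" using N \<open>Z x \<le> Z b\<close> by auto
  have "x \<noteq> e/2" using dec[of "e/2" e] x(2)[of e] N \<open>e \<le> b\<close> \<open>0 < e\<close> by auto
  have "e/2 < x" "x < N" using x(1) \<open>x \<noteq> N\<close> \<open>x \<noteq> e/2\<close> by auto
  have "- (x * D x) = 0"
  proof (rule DERIV_local_min[OF dZ])
    show "0 < min (x - e/2) (N - x)" using \<open>e/2 < x\<close> \<open>x < N\<close> by simp
    show "\<forall>y. \<bar>x - y\<bar> < min (x - e/2) (N - x) \<longrightarrow> Z x \<le> Z y"
      by (intro allI impI x(2)) (auto simp: abs_less_iff)
  qed
  then have "0 \<le> Z x" using crit[of x] \<open>e/2 < x\<close> \<open>0 < e\<close> by auto
  then show False using \<open>Z x \<le> Z b\<close> \<open>Z b < 0\<close> by simp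
qed

text \<open>\<open>Z\<close> would be increasing to \<open>0\<close>, hence negative, from the last zero of \<open>D\<close> on.\<close>

lemma not_eventually_neg:
  fixes H D Z :: "real \<Rightarrow> real"
  assumes H0: "H 0 = 0" and H1: "(H \<longlongrightarrow> 0) at_top" and dH: "\<And>x. (H has_field_derivative D x) (at x)"
    and Z1: "(Z \<longlongrightarrow> 0) at_top" and dZ: "\<And>x. (Z has_field_derivative - (x * D x)) (at x)"
    and crit: "\<And>x. 0 < x \<Longrightarrow> D x = 0 \<Longrightarrow> 0 \<le> Z x"
    and cont: "continuous_on UNIV D"
  shows "\<not> eventually (\<lambda>x. D x < 0) at_top"
proof
  assume "eventually (\<lambda>x. D x < 0) at_top"
  then obtain N where N: "\<And>x. N \<le> x \<Longrightarrow> D x < 0" by (auto simp: eventually_at_top_linorder)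
  obtain x0 where x0: "0 < x0" "0 \<le> D x0"
    using exists_nonneg_of_vanishing_integral[OF H0 H1 dH] by auto
  \<comment> \<open>Past \<open>N\<close> the function \<open>D\<close> is negative, so cutting off
    at \<open>N\<close> loses nothing and makes \<open>S\<close> compact; its maximum
    \<open>c\<close> is the last point with \<open>D \<ge> 0\<close>, hence a zero of
    \<open>D\<close>.\<close>
  define S where "S = {x \<in> {x0..N}. 0 \<le> D x}"
  have "x0 \<in> S" using x0 N[of x0] by (cases "N \<le> x0") (auto simp: S_def)
  have "S = {x0..N} \<inter> D -` {0..}" by (auto simp: S_def)
  then have "compact S"
    using closed_vimage[OF closed_atLeast[of 0] cont] by (simp add: compact_Int_closed)
  then obtain c where c: "c \<in> S" "\<And>x. x \<in> S \<Longrightarrow> x \<le> c"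
    using compact_attains_sup[of S] \<open>x0 \<in> S\<close> by auto
  have "0 < c" using c(1) x0 by (auto simp: S_def)
  have neg: "D x < 0" if "c < x" for x
    using c(2)[of x] c(1) N[of x] that by (fastforce simp: S_def)
  have "D c \<le> 0"
  proof (rule tendsto_upperbound)
    show "(D \<longlongrightarrow> D c) (at_right c)"
      using cont by (auto simp: continuous_on_def intro: filterlim_mono[OF _ order_refl at_le])
    show "eventually (\<lambda>x. D x \<le> 0) (at_right c)"
      using neg by (intro eventually_at_rightI[of c "c + 1"]) (auto intro: less_imp_le)
  qed simp
  then have "D c = 0" using c(1) by (simp add: S_def)
  have inc: "Z x < Z y" if "c \<le> x" "x < y" for x y
  proof (rule DERIV_pos_imp_increasing_open[OF that(2)])
    fix t assume "x < t" "t < y"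
    then show "\<exists>d. (Z has_field_derivative d) (at t) \<and> 0 < d"
      using neg[of t] that \<open>0 < c\<close> by (intro exI[of _ "- (t * D t)"] conjI dZ) (simp add: mult_pos_neg)
  next
    show "continuous_on {x..y} Z"
      using dZ by (intro DERIV_continuous_on[of _ Z "\<lambda>x. - (x * D x)"]) (auto intro: has_field_derivative_at_within)
  qed
  \<comment> \<open>The limit only gives a weak inequality; the detour through \<open>c + 1\<close>
    makes \<open>Z c\<close> strictly negative.\<close>
  have "Z (c + 1) \<le> 0"
    by (rule tendsto_lowerbound[OF Z1])
       (use inc[of "c + 1"] in \<open>auto intro!: eventually_at_top_linorderI[of "c + 1"] simp: le_less\<close>)
  then have "Z c < 0" using inc[of c "c + 1"] by simp
  then show False using crit[OF \<open>0 < c\<close> \<open>D c = 0\<close>] by simp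
qed

lemma Zfun_nonneg:
  assumes ij: "1 \<le> i" "i \<le> n" "1 \<le> j" "j \<le> m"
    and crit: "\<And>x. 0 < x \<Longrightarrow> exp_os_density i n x = exp_os_density j m x \<Longrightarrow> 0 \<le> Zfun i n j m x"
    and "0 < a"
  shows "0 \<le> Zfun i n j m a"
proof -
  define D where "D = (\<lambda>x. exp_os_density i n x - exp_os_density j m x)"
  define H where "H = (\<lambda>x. binomial_tail i n (1 - exp (-x)) - binomial_tail j m (1 - exp (-x)))"
  have H: "H 0 = 0" "(H \<longlongrightarrow> 0) at_top" "\<And>x. (H has_field_derivative D x) (at x)"
    using exp_os_cdf_diff[OF ij] by (auto simp: H_def D_def)
  have Z: "(Zfun i n j m \<longlongrightarrow> 0) at_top" "\<And>x. (Zfun i n j m has_field_derivative - (x * D x)) (at x)"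
    using Zfun_asymp[OF ij] by (auto simp: D_def)
  have crit': "0 \<le> Zfun i n j m x" if "0 < x" "D x = 0" for x
    using crit that by (simp add: D_def)
  define p q where "p = real i * real (n choose i)" and "q = real j * real (m choose j)"
  have pq: "0 < p" "0 < q" using ij by (auto simp: p_def q_def)
  have D: "D t = p * (1 - exp (-t)) ^ (i - 1) * exp (-t) ^ (n - i + 1)
      - q * (1 - exp (-t)) ^ (j - 1) * exp (-t) ^ (m - j + 1)" for t
    by (simp add: D_def exp_os_density_def p_def q_def)
  \<comment> \<open>The sign of \<open>D\<close> near 0 is governed by \<open>i\<close> against
    \<open>j\<close>, and at infinity by \<open>n - i\<close> against \<open>m - j\<close>. In each
    case \<open>B\<close> is \<open>D\<close> divided by a factor positive on
    \<open>t > 0\<close>.\<close>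
  consider "i < j" | "j \<le> i" "n - i \<le> m - j" | "j \<le> i" "m - j < n - i" by linarith
  then show ?thesis
  proof cases
    case 1
    define B where "B t = p * exp (-t) ^ (n - i + 1) - q * (1 - exp (-t)) ^ (j - i) * exp (-t) ^ (m - j + 1)" for t :: real
    have DB: "D t = (1 - exp (-t)) ^ (i - 1) * B t" for t
    proof -
      have "j - 1 = (i - 1) + (j - i)" using 1 ij by simp
      then have "(1 - exp (-t)) ^ (j - 1) = (1 - exp (-t)) ^ (i - 1) * (1 - exp (-t)) ^ (j - i)"
        by (metis power_add)
      then show ?thesis by (simp add: D B_def algebra_simps)
    qed
    have "isCont B 0" unfolding B_def by (intro continuous_intros)
    then have "(B \<longlongrightarrow> B 0) (at_right 0)" by (auto simp: isCont_def intro: tendsto_within_subset)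
    \<comment> \<open>Since \<open>j - i > 0\<close>, the second term vanishes at 0 and
      \<open>B 0 = p\<close>.\<close>
    moreover have "0 < B 0" using 1 pq by (simp add: B_def power_0_left)
    ultimately have "eventually (\<lambda>t. 0 < B t) (at_right 0)" by (rule order_tendstoD(1))
    then obtain b where b: "0 < b" "\<And>t. 0 < t \<Longrightarrow> t < b \<Longrightarrow> 0 < B t"
      by (auto simp: eventually_at_right_field)
    show ?thesis
      by (rule nonneg_of_nonneg_at_critical_points[OF Z crit' _ _ \<open>0 < a\<close>, of "b/2"])
        (use b in \<open>auto simp: DB\<close>)
  next
    case 2
    define B where "B t = p * (1 - exp (-t)) ^ (i - j) - q * exp (-t) ^ ((m - j) - (n - i))" for t :: real
    have DB: "D t = (1 - exp (-t)) ^ (j - 1) * exp (-t) ^ (n - i + 1) * B t" for t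
    proof -
      have "i - 1 = (j - 1) + (i - j)" "m - j + 1 = (n - i + 1) + ((m - j) - (n - i))" using 2 ij by simp_all
      then have "(1 - exp (-t)) ^ (i - 1) = (1 - exp (-t)) ^ (j - 1) * (1 - exp (-t)) ^ (i - j)"
        "exp (-t) ^ (m - j + 1) = exp (-t) ^ (n - i + 1) * exp (-t) ^ ((m - j) - (n - i))"
        by (metis power_add)+
      then show ?thesis by (simp add: D B_def algebra_simps)
    qed
    have sgnD: "0 \<le> D t \<longleftrightarrow> 0 \<le> B t" if "0 < t" for t
    proof -
      define c where "c = (1 - exp (-t)) ^ (j - 1) * exp (-t) ^ (n - i + 1)"
      have "0 < c" using that by (simp add: c_def)
      then show ?thesis unfolding DB c_def[symmetric] by (simp add: zero_le_mult_iff)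
    qed
    \<comment> \<open>Both remaining exponents are natural numbers, so the first term increases and
      the subtracted one decreases: the sign can only switch from negative to nonnegative.\<close>
    have "B x \<le> B y" if "0 < x" "x \<le> y" for x y
      unfolding B_def using that pq by (intro diff_mono mult_left_mono power_mono) auto
    then show ?thesis
      by (intro nonneg_of_single_crossing[OF H Z _ \<open>0 < a\<close>]) (force simp: sgnD)
  next
    case 3
    define B where "B t = p * (1 - exp (-t)) ^ (i - 1) * exp (-t) ^ ((n - i) - (m - j)) - q * (1 - exp (-t)) ^ (j - 1)" for t :: real
    have DB: "D t = exp (-t) ^ (m - j + 1) * B t" for t
    proof -
      have "n - i + 1 = (m - j + 1) + ((n - i) - (m - j))" using 3 by simp
      then have "exp (-t) ^ (n - i + 1) = exp (-t) ^ (m - j + 1) * exp (-t) ^ ((n - i) - (m - j))"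
        by (metis power_add)
      then show ?thesis by (simp add: D B_def algebra_simps)
    qed
    have e: "((\<lambda>t::real. exp (-t)) \<longlongrightarrow> 0) at_top" by real_asymp
    have lim: "(B \<longlongrightarrow> p * (1 - 0) ^ (i - 1) * 0 ^ ((n - i) - (m - j)) - q * (1 - 0) ^ (j - 1)) at_top"
      unfolding B_def by (intro tendsto_intros e)
    have zero: "(0::real) ^ ((n - i) - (m - j)) = 0" using 3 by (simp only: power_0_left) simp
    have "(B \<longlongrightarrow> - q) at_top" using lim unfolding zero by simp
    then have "eventually (\<lambda>t. B t < 0) at_top" using pq by (intro order_tendstoD(2)) auto
    then have "eventually (\<lambda>t. D t < 0) at_top"
      by eventually_elim (simp add: DB mult_pos_neg)
    moreover have "continuous_on UNIV D"
      unfolding D_def by (intro continuous_intros continuous_exp_os_density)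
    ultimately show ?thesis using not_eventually_neg[OF H Z crit'] by blast
  qed
qed

subsection \<open>The law of an order statistic\<close>

text \<open>In a sorted list the entries \<open>\<le> x\<close> form an initial segment; the
  zero-based position \<open>k\<close> lies in it iff the segment has more than \<open>k\<close>
  entries.\<close>

lemma sorted_nth_le_iff:
  fixes ys :: "'a :: linorder list"
  assumes "sorted ys" "k < length ys"
  shows "ys ! k \<le> x \<longleftrightarrow> k < length (filter (\<lambda>y. y \<le> x) ys)"
  using assms
proof (induction ys arbitrary: k)
  case (Cons y ys)
  have *: "filter (\<lambda>y. y \<le> x) ys = []" if "\<not> y \<le> x"
    using that Cons.prems by (auto simp: filter_empty_conv)
  show ?case
  proof (cases k)
    case 0
    then show ?thesis using * by auto
  next
    case (Suc l)
    then show ?thesis using Cons * by (auto simp: not_le)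
  qed
qed simp

lemma sort_nth_le_iff:
  fixes f :: "nat \<Rightarrow> 'a :: linorder"
  assumes "1 \<le> i" "i \<le> N"
  shows "sort (map f [0..<N]) ! (i - 1) \<le> x \<longleftrightarrow> i \<le> card {l \<in> {..<N}. f l \<le> x}"
proof -
  have "length (filter (\<lambda>y. y \<le> x) (sort (map f [0..<N]))) = length (filter (\<lambda>y. y \<le> x) (map f [0..<N]))"
    by (metis mset_filter mset_sort size_mset)
  also have "\<dots> = card {l \<in> {..<N}. f l \<le> x}"
    by (auto simp: length_filter_conv_card intro!: arg_cong[where f=card])
  finally show ?thesis
    using sorted_nth_le_iff[of "sort (map f [0..<N])" "i - 1" x] assms by auto
qed

text \<open>Partition the event by the exact set \<open>T\<close> of coordinates that fall in
  \<open>A\<close>. Each cell \<open>C T\<close> is a measurable box whose probability depends only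
  on \<open>card T\<close>, and grouping by cardinality gives the binomial sum.\<close>

lemma (in prob_space) measure_PiM_card_ge:
  fixes i N :: nat
  assumes A: "A \<in> events"
  defines "S \<equiv> {\<omega> \<in> space (PiM {..<N} (\<lambda>_. M)). i \<le> card {l \<in> {..<N}. \<omega> l \<in> A}}"
  shows "S \<in> sets (PiM {..<N} (\<lambda>_. M))"
    and "measure (PiM {..<N} (\<lambda>_. M)) S = binomial_tail i N (prob A)"
proof -
  interpret P: product_prob_space "\<lambda>_. M" "{..<N}" ..
  interpret P: finite_product_prob_space "\<lambda>_. M" "{..<N}" by unfold_locales simp
  let ?P = "PiM {..<N} (\<lambda>_. M)"
  define C where "C T = Pi\<^sub>E {..<N} (\<lambda>l. if l \<in> T then A else space M - A)" for T
  define \<T> where "\<T> = {T. T \<subseteq> {..<N} \<and> i \<le> card T}"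
  have fin: "finite \<T>" unfolding \<T>_def by (rule finite_subset[of _ "Pow {..<N}"]) auto
  have C_iff: "\<omega> \<in> C T \<longleftrightarrow> \<omega> \<in> space ?P \<and> {l \<in> {..<N}. \<omega> l \<in> A} = T" if "T \<subseteq> {..<N}" for T \<omega>
    using that sets.sets_into_space[OF A]
    by (auto simp: C_def space_PiM PiE_iff split: if_splits)
  have C_sets: "C T \<in> sets ?P" for T
    unfolding C_def using A by (intro sets_PiM_I_finite) auto
  have S: "S = (\<Union>T\<in>\<T>. C T)"
    unfolding S_def \<T>_def by (auto simp: C_iff)
  show "S \<in> sets ?P" unfolding S using fin C_sets by auto
  have prob_C: "measure ?P (C T) = prob A ^ card T * (1 - prob A) ^ (N - card T)"
    if "T \<subseteq> {..<N}" for T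
  proof -
    have "measure ?P (C T) = (\<Prod>l<N. prob (if l \<in> T then A else space M - A))"
      unfolding C_def using A by (intro P.prob_times) auto
    also have "\<dots> = (\<Prod>l<N. if l \<in> T then prob A else 1 - prob A)"
      using A by (intro prod.cong) (auto simp: prob_compl)
    also have "\<dots> = prob A ^ card T * (1 - prob A) ^ card ({..<N} - T)"
      using that by (simp add: prod.If_cases Int_absorb1 Diff_eq)
    finally show ?thesis
      using that by (simp add: card_Diff_subset finite_subset)
  qed
  have "measure ?P S = (\<Sum>T\<in>\<T>. measure ?P (C T))"
    unfolding S
  proof (rule P.finite_measure_finite_Union)
    show "disjoint_family_on C \<T>"
      using C_iff by (auto simp: disjoint_family_on_def \<T>_def)
  qed (use fin C_sets in auto)
  also have "\<dots> = (\<Sum>T\<in>\<T>. prob A ^ card T * (1 - prob A) ^ (N - card T))"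
    by (intro sum.cong prob_C) (auto simp: \<T>_def)
  also have "\<dots> = (\<Sum>k=i..N. \<Sum>T\<in>{T \<in> \<T>. card T = k}. prob A ^ card T * (1 - prob A) ^ (N - card T))"
    using fin by (intro sum.group[symmetric]) (auto simp: \<T>_def dest: card_mono[OF finite_lessThan])
  also have "\<dots> = (\<Sum>k=i..N. real (N choose k) * prob A ^ k * (1 - prob A) ^ (N - k))"
  proof (intro sum.cong refl)
    fix k assume k: "k \<in> {i..N}"
    then have "{T \<in> \<T>. card T = k} = {T. T \<subseteq> {..<N} \<and> card T = k}" by (auto simp: \<T>_def)
    moreover have "card {T. T \<subseteq> {..<N} \<and> card T = k} = N choose k"
      using n_subsets[of "{..<N}" k] by simp
    ultimately show "(\<Sum>T\<in>{T \<in> \<T>. card T = k}. prob A ^ card T * (1 - prob A) ^ (N - card T))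
       = real (N choose k) * prob A ^ k * (1 - prob A) ^ (N - k)"
      by simp
  qed
  finally show "measure ?P S = binomial_tail i N (prob A)" by (simp add: binomial_tail_def)
qed

lemma order_stat_cdf:
  assumes "real_distribution M" "1 \<le> i" "i \<le> N"
  shows "real_distribution (order_stat M i N)"
    and "cdf (order_stat M i N) x = binomial_tail i N (cdf M x)"
proof -
  interpret M: real_distribution M by fact
  interpret P: product_prob_space "\<lambda>_. M" "{..<N}" ..
  let ?P = "PiM {..<N} (\<lambda>_. M)"
  let ?f = "\<lambda>\<omega>. sort (map \<omega> [0..<N]) ! (i - 1)"
  have pre: "{\<omega> \<in> space ?P. ?f \<omega> \<le> x} = {\<omega> \<in> space ?P. i \<le> card {l \<in> {..<N}. \<omega> l \<in> {..x}}}" for x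
    using assms by (simp only: sort_nth_le_iff atMost_iff)
  have f: "?f \<in> borel_measurable ?P"
    unfolding borel_measurable_iff_le pre by (intro allI M.measure_PiM_card_ge) simp
  show "real_distribution (order_stat M i N)"
    unfolding order_stat_def using f by (intro P.P.real_distribution_distr)
  have "cdf (order_stat M i N) x = measure ?P {\<omega> \<in> space ?P. ?f \<omega> \<le> x}"
    unfolding cdf_def order_stat_def using f
    by (subst measure_distr) (auto intro!: arg_cong[where f="measure ?P"])
  then show "cdf (order_stat M i N) x = binomial_tail i N (cdf M x)"
    using M.measure_PiM_card_ge(2)[where A="{..x}" and i=i and N=N]
    unfolding pre by (simp add: cdf_def del: atMost_iff)
qed

text \<open>Layer-cake representation: \<open>h\<close> is a mixture of indicators of upper half-lines.\<close>

lemma nn_integral_mono_tail_dominance: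
  fixes h :: "real \<Rightarrow> real" and \<mu> \<nu> :: "real measure"
  assumes "sigma_finite_measure \<mu>" "sigma_finite_measure \<nu>"
    and sets: "sets \<mu> = sets borel" "sets \<nu> = sets borel"
    and "mono h" and h0: "\<And>x. x \<le> 0 \<Longrightarrow> h x = 0"
    and Ici: "\<And>a. 0 \<le> a \<Longrightarrow> emeasure \<mu> {a..} \<le> emeasure \<nu> {a..}"
    and Ioi: "\<And>a. 0 \<le> a \<Longrightarrow> emeasure \<mu> {a<..} \<le> emeasure \<nu> {a<..}"
  shows "(\<integral>\<^sup>+x. ennreal (h x) \<partial>\<mu>) \<le> (\<integral>\<^sup>+x. ennreal (h x) \<partial>\<nu>)"
proof -
  have [measurable]: "h \<in> borel_measurable borel" using \<open>mono h\<close> by (rule borel_measurable_mono)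
  \<comment> \<open>Write \<open>ennreal (h x)\<close> as the length of \<open>{0..<h x}\<close>,
    also correct for negative \<open>h x\<close>, and exchange the integrals by Tonelli.\<close>
  have layer: "(\<integral>\<^sup>+x. ennreal (h x) \<partial>\<rho>) = (\<integral>\<^sup>+t. indicator {0..} t * emeasure \<rho> {x. t < h x} \<partial>lborel)"
    if "sigma_finite_measure \<rho>" and [measurable_cong]: "sets \<rho> = sets borel" for \<rho>
  proof -
    interpret pair_sigma_finite \<rho> lborel
      using that lborel.sigma_finite_measure_axioms by (simp add: pair_sigma_finite_def)
    have sp: "space \<rho> = UNIV" using sets_eq_imp_space_eq[OF that(2)] by simp
    have "(\<integral>\<^sup>+x. ennreal (h x) \<partial>\<rho>) = (\<integral>\<^sup>+x. (\<integral>\<^sup>+t. indicator {(x, t). 0 \<le> t \<and> t < h x} (x, t) \<partial>lborel) \<partial>\<rho>)"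
    proof (intro nn_integral_cong)
      fix x
      have "(\<integral>\<^sup>+t. indicator {(x, t). 0 \<le> t \<and> t < h x} (x, t) \<partial>lborel) = (\<integral>\<^sup>+t. indicator {0..<h x} t \<partial>lborel)"
        by (intro nn_integral_cong) (simp add: indicator_def)
      then show "ennreal (h x) = (\<integral>\<^sup>+t. indicator {(x, t). 0 \<le> t \<and> t < h x} (x, t) \<partial>lborel)"
        by (cases "0 \<le> h x") (auto simp: ennreal_neg)
    qed
    also have "\<dots> = (\<integral>\<^sup>+t. (\<integral>\<^sup>+x. indicator {(x, t). 0 \<le> t \<and> t < h x} (x, t) \<partial>\<rho>) \<partial>lborel)"
      by (intro Fubini'[symmetric]) measurable
    also have "\<dots> = (\<integral>\<^sup>+t. (\<integral>\<^sup>+x. indicator {0..} t * indicator {x. t < h x} x \<partial>\<rho>) \<partial>lborel)"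
      by (intro nn_integral_cong) (auto simp: indicator_def)
    also have "\<dots> = (\<integral>\<^sup>+t. indicator {0..} t * emeasure \<rho> {x. t < h x} \<partial>lborel)"
      by (intro nn_integral_cong) (simp add: nn_integral_cmult sp)
    finally show ?thesis .
  qed
  have "emeasure \<mu> {x. t < h x} \<le> emeasure \<nu> {x. t < h x}" if "0 \<le> t" for t
  proof (cases "{x. t < h x} = {}")
    case False
    \<comment> \<open>By monotonicity the superlevel set is a half-line starting at its infimum,
      which is nonnegative by \<open>h0\<close>. It may or may not contain its endpoint, hence the
      two tail hypotheses.\<close>
    define a where "a = Inf {x. t < h x}"
    have pos: "0 < x" if "t < h x" for x using h0[of x] that \<open>0 \<le> t\<close> by force
    have bdd: "bdd_below {x. t < h x}" using pos by (intro bdd_belowI[of _ 0]) (auto intro: less_imp_le)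
    have "0 \<le> a" unfolding a_def using False pos by (intro cInf_greatest) (auto intro: less_imp_le)
    have ge: "a \<le> x" if "t < h x" for x unfolding a_def using that bdd by (intro cInf_lower) auto
    have gt: "t < h x" if ax: "a < x" for x
    proof -
      obtain y where "t < h y" "y < x" using cInf_lessD[OF False, of x] ax by (auto simp: a_def)
      then show ?thesis using monoD[OF \<open>mono h\<close>, of y x] by simp
    qed
    show ?thesis
    proof (cases "t < h a")
      case True
      then have "t < h x \<longleftrightarrow> a \<le> x" for x using ge[of x] gt[of x] by (cases "x = a") auto
      then have "{x. t < h x} = {a..}" by auto
      then show ?thesis using Ici[OF \<open>0 \<le> a\<close>] by simp
    next
      case False
      then have "t < h x \<longleftrightarrow> a < x" for x using ge[of x] gt[of x] by (cases "x = a") auto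
      then have "{x. t < h x} = {a<..}" by auto
      then show ?thesis using Ioi[OF \<open>0 \<le> a\<close>] by simp
    qed
  qed simp
  then show ?thesis
    unfolding layer[OF assms(1) sets(1)] layer[OF assms(2) sets(2)]
    by (intro nn_integral_mono) (auto simp: indicator_def)
qed

section \<open>Laws and moment measures of exponential order statistics\<close>

definition exp_os_law :: "nat \<Rightarrow> nat \<Rightarrow> real measure" where
  "exp_os_law i n = density lborel (\<lambda>t. ennreal (exp_os_density i n t) * indicator {0<..} t)"

text \<open>The weight \<open>t\<close> is moved into the measure, so that the tails become
  \<open>exp_os_moment\<close> and the integrand left over is \<open>u (Q t) / t\<close>, which is
  monotone.\<close>

definition exp_os_moment_measure :: "nat \<Rightarrow> nat \<Rightarrow> real measure" where
  "exp_os_moment_measure i n = density lborel (\<lambda>t. ennreal (t * exp_os_density i n t) * indicator {0<..} t)"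

lemma nn_integral_indicator_Ioi_eq_Ici:
  fixes f :: "real \<Rightarrow> ennreal"
  shows "(\<integral>\<^sup>+t. f t * indicator {a<..} t \<partial>lborel) = (\<integral>\<^sup>+t. f t * indicator {a..} t \<partial>lborel)"
  by (rule nn_integral_cong_AE, rule eventually_mono[OF AE_lborel_singleton[of a]])
     (auto simp: indicator_def)

lemma emeasure_exp_os_law:
  assumes "1 \<le> i" "i \<le> n" "0 \<le> a"
  shows "emeasure (exp_os_law i n) {a<..} = ennreal (1 - binomial_tail i n (1 - exp (-a)))"
proof -
  have "emeasure (exp_os_law i n) {a<..}
      = (\<integral>\<^sup>+t. ennreal (exp_os_density i n t) * indicator {a<..} t \<partial>lborel)"
    unfolding exp_os_law_def using assms
    by (subst emeasure_density) (auto intro!: nn_integral_cong simp: indicator_def)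
  also have "\<dots> = ennreal (1 - binomial_tail i n (1 - exp (-a)))"
    unfolding nn_integral_indicator_Ioi_eq_Ici using assms
    by (intro nn_integral_FTC_atLeast has_field_derivative_exp_os_cdf exp_os_density_nonneg tendsto_exp_os_cdf) auto
  finally show ?thesis .
qed

lemma prob_space_exp_os_law:
  assumes "1 \<le> i" "i \<le> n"
  shows "prob_space (exp_os_law i n)"
proof
  have "emeasure (exp_os_law i n) (space (exp_os_law i n)) = emeasure (exp_os_law i n) {0<..}"
    unfolding exp_os_law_def by (auto simp: emeasure_density indicator_def intro!: nn_integral_cong)
  also have "\<dots> = 1" using assms by (simp add: emeasure_exp_os_law binomial_tail_0)
  finally show "emeasure (exp_os_law i n) (space (exp_os_law i n)) = 1" .
qed

lemma emeasure_exp_os_moment_measure: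
  assumes "1 \<le> i" "i \<le> n" "0 \<le> a"
  shows "emeasure (exp_os_moment_measure i n) {a<..} = ennreal (exp_os_moment i n a)"
    and "emeasure (exp_os_moment_measure i n) {a..} = ennreal (exp_os_moment i n a)"
proof -
  have *: "(\<integral>\<^sup>+t. ennreal (t * exp_os_density i n t) * indicator {a..} t \<partial>lborel) = ennreal (0 - (- exp_os_moment i n a))"
  proof (rule nn_integral_FTC_atLeast)
    show "((\<lambda>t. - exp_os_moment i n t) has_field_derivative t * exp_os_density i n t) (at t)" for t
      using DERIV_minus[OF has_field_derivative_exp_os_moment[OF assms(1,2)]] by simp
    show "((\<lambda>t. - exp_os_moment i n t) \<longlongrightarrow> 0) at_top"
      using tendsto_minus[OF tendsto_exp_os_moment[OF assms(1,2)]] by simp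
  qed (use assms in \<open>auto intro!: mult_nonneg_nonneg exp_os_density_nonneg\<close>)
  have "emeasure (exp_os_moment_measure i n) {a<..}
      = (\<integral>\<^sup>+t. ennreal (t * exp_os_density i n t) * indicator {a<..} t \<partial>lborel)"
    unfolding exp_os_moment_measure_def using assms
    by (subst emeasure_density) (auto intro!: nn_integral_cong simp: indicator_def)
  then show "emeasure (exp_os_moment_measure i n) {a<..} = ennreal (exp_os_moment i n a)"
    unfolding nn_integral_indicator_Ioi_eq_Ici * by simp
  \<comment> \<open>The indicators can disagree only at \<open>t = 0\<close>, where the factor
    \<open>t\<close> vanishes.\<close>
  have "ennreal (t * exp_os_density i n t) * indicator {0<..} t * indicator {a..} t
      = ennreal (t * exp_os_density i n t) * indicator {a..} t" for t
    using assms by (cases "t = 0") (auto simp: indicator_def)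
  then have "emeasure (exp_os_moment_measure i n) {a..}
      = (\<integral>\<^sup>+t. ennreal (t * exp_os_density i n t) * indicator {a..} t \<partial>lborel)"
    unfolding exp_os_moment_measure_def by (subst emeasure_density) auto
  then show "emeasure (exp_os_moment_measure i n) {a..} = ennreal (exp_os_moment i n a)"
    unfolding * by simp
qed

lemma sigma_finite_exp_os_moment_measure:
  assumes "1 \<le> i" "i \<le> n"
  shows "sigma_finite_measure (exp_os_moment_measure i n)"
proof -
  have "emeasure (exp_os_moment_measure i n) (space (exp_os_moment_measure i n))
      = emeasure (exp_os_moment_measure i n) {0<..}"
    unfolding exp_os_moment_measure_def by (auto simp: emeasure_density indicator_def intro!: nn_integral_cong)
  then have "finite_measure (exp_os_moment_measure i n)"
    using assms by (intro finite_measureI) (simp add: emeasure_exp_os_moment_measure)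
  then show ?thesis by (simp add: finite_measure_def)
qed

section \<open>Representing general order statistics through exponential ones\<close>

locale nonneg_distribution = real_distribution +
  assumes nonneg: "AE x in M. 0 \<le> x"
begin

text \<open>The function \<open>F\<^sup>-\<^sup>1 \<circ> \<E>\<close>, extended by \<open>0\<close> since the quantile at \<open>p \<le> 0\<close> is a junk infimum.\<close>

definition Q :: "real \<Rightarrow> real" where
  "Q t = (if 0 < t then quantile (cdf M) (1 - exp (-t)) else 0)"

text \<open>This is the Galois connection between a CDF and its quantile function, valid for levels
  strictly between 0 and 1; \<open>t > 0\<close> puts \<open>1 - exp (-t)\<close> there.\<close>

lemma Q_le_iff:
  assumes "0 < t"
  shows "Q t \<le> x \<longleftrightarrow> 1 - exp (-t) \<le> cdf M x"
proof -
  interpret right_continuous_mono "cdf M" 0 1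
    by standard (auto simp: cdf_is_right_cont mono_def cdf_nondecreasing cdf_lim_at_bot cdf_lim_at_top_prob)
  show ?thesis using assms pseudoinverse[of "1 - exp (-t)" x] by (simp add: Q_def quantile_def)
qed

lemma cdf_neg: "x < 0 \<Longrightarrow> cdf M x = 0"
  unfolding cdf_def using nonneg by (subst prob_eq_0) (auto elim: eventually_mono)

lemma Q_nonneg: "0 \<le> Q t"
proof (rule ccontr)
  assume *: "\<not> 0 \<le> Q t"
  then have t: "0 < t" by (auto simp: Q_def split: if_splits)
  then show False using Q_le_iff[OF t, of "Q t"] cdf_neg[of "Q t"] * by simp
qed

lemma mono_Q: "mono Q"
proof (rule monoI)
  fix s t :: real assume st: "s \<le> t"
  show "Q s \<le> Q t"
  proof (cases "0 < s")
    case True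
    then have "1 - exp (-s) \<le> 1 - exp (-t)" "1 - exp (-t) \<le> cdf M (Q t)"
      using st Q_le_iff[of t "Q t"] by auto
    then have "1 - exp (-s) \<le> cdf M (Q t)" by (rule order_trans)
    then show ?thesis using Q_le_iff[OF True] by simp
  qed (use Q_nonneg in \<open>auto simp: Q_def\<close>)
qed

lemma measurable_Q[measurable]: "Q \<in> borel_measurable borel"
  by (rule borel_measurable_mono[OF mono_Q])

text \<open>Both CDFs equal \<open>binomial_tail i n (cdf M x)\<close>: by \<open>Q_le_iff\<close>,
  \<open>Q t \<le> x\<close> means \<open>t \<le> a\<close> where
  \<open>1 - exp (-a) = cdf M x\<close>.\<close>

lemma order_stat_eq_distr_exp_os_law:
  assumes "1 \<le> i" "i \<le> n"
  shows "order_stat M i n = distr (exp_os_law i n) borel Q"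
proof (rule cdf_unique[OF order_stat_cdf(1)[OF real_distribution_axioms assms]])
  interpret L: prob_space "exp_os_law i n" using assms by (rule prob_space_exp_os_law)
  have [measurable_cong]: "sets (exp_os_law i n) = sets borel"
    and sp: "space (exp_os_law i n) = UNIV" by (simp_all add: exp_os_law_def)
  show "real_distribution (distr (exp_os_law i n) borel Q)"
    by (intro L.real_distribution_distr) measurable
  show "cdf (order_stat M i n) = cdf (distr (exp_os_law i n) borel Q)"
  proof
    fix x
    have "cdf (distr (exp_os_law i n) borel Q) x = L.prob {t. Q t \<le> x}"
      unfolding cdf_def by (subst measure_distr) (auto simp: sp vimage_def)
    also have "\<dots> = binomial_tail i n (cdf M x)"
    proof -
      \<comment> \<open>A finite cutoff \<open>a\<close> exists only if \<open>cdf M x < 1\<close>;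
        for \<open>x < 0\<close> the event is empty since \<open>Q\<close> is nonnegative.\<close>
      consider "x < 0" | "0 \<le> x" "cdf M x = 1" | "0 \<le> x" "cdf M x < 1"
        using cdf_bounded_prob[of x] by linarith
      then show ?thesis
      proof cases
        case 1
        have "\<not> Q t \<le> x" for t using Q_nonneg[of t] 1 by simp
        then have "{t. Q t \<le> x} = {}" by simp
        then show ?thesis using assms 1 by (simp add: cdf_neg binomial_tail_0)
      next
        case 2
        then have "Q t \<le> x" for t by (cases "0 < t") (simp add: Q_le_iff, simp add: Q_def)
        then have "{t. Q t \<le> x} = space (exp_os_law i n)" by (simp add: sp)
        then show ?thesis using 2 assms by (simp add: L.prob_space binomial_tail_1)
      next
        case 3
        define a where "a = - ln (1 - cdf M x)"
        have a: "0 \<le> a" "1 - exp (-a) = cdf M x"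
          using 3 cdf_nonneg[of x] by (auto simp: a_def)
        have "Q t \<le> x \<longleftrightarrow> t \<le> a" for t
        proof (cases "0 < t")
          case True
          then show ?thesis unfolding Q_le_iff[OF True] a(2)[symmetric] by simp
        qed (use 3(1) a(1) in \<open>simp add: Q_def\<close>)
        then have "{t. Q t \<le> x} = UNIV - {a<..}" by (simp add: set_eq_iff not_less)
        moreover have "L.prob {a<..} = 1 - binomial_tail i n (cdf M x)"
        proof -
          \<comment> \<open>Needed because \<open>ennreal\<close> truncates negative values; the
            bound holds since the tail is itself a CDF value.\<close>
          have "0 \<le> 1 - binomial_tail i n (cdf M x)"
          proof -
            have "cdf (order_stat M i n) x \<le> 1"
              using order_stat_cdf(1)[OF real_distribution_axioms assms]
              by (rule real_distribution.cdf_bounded_prob)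
            then show ?thesis using order_stat_cdf(2)[OF real_distribution_axioms assms] by simp
          qed
          then show ?thesis
            using emeasure_exp_os_law[OF assms a(1)] by (simp add: measure_def a(2))
        qed
        moreover have "L.prob (UNIV - {a<..}) = 1 - L.prob {a<..}"
          using L.prob_compl[of "{a<..}"] by (simp add: sp)
        ultimately show ?thesis by simp
      qed
    qed
    finally show "cdf (order_stat M i n) x = cdf (distr (exp_os_law i n) borel Q) x"
      using order_stat_cdf(2)[OF real_distribution_axioms assms] by simp
  qed
qed

section \<open>Comparison of expectations of star-shaped functions\<close>

lemma nn_integral_order_stat:
  assumes "1 \<le> i" "i \<le> n" "u \<in> borel_measurable borel" and nonneg: "\<And>x. 0 \<le> x \<Longrightarrow> 0 \<le> u x"
  shows "(\<integral>\<^sup>+x. ennreal (u x) \<partial>order_stat M i n)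
    = (\<integral>\<^sup>+t. ennreal (if 0 < t then u (Q t) / t else 0) \<partial>exp_os_moment_measure i n)"
proof -
  note [measurable] = assms(3)
  have "(\<integral>\<^sup>+x. ennreal (u x) \<partial>order_stat M i n) = (\<integral>\<^sup>+t. ennreal (u (Q t)) \<partial>exp_os_law i n)"
    unfolding order_stat_eq_distr_exp_os_law[OF assms(1,2)]
    by (subst nn_integral_distr) (auto simp: exp_os_law_def)
  also have "\<dots> = (\<integral>\<^sup>+t. ennreal (exp_os_density i n t) * indicator {0<..} t * ennreal (u (Q t)) \<partial>lborel)"
    unfolding exp_os_law_def by (subst nn_integral_density) auto
  also have "\<dots> = (\<integral>\<^sup>+t. ennreal (t * exp_os_density i n t) * indicator {0<..} t
      * ennreal (if 0 < t then u (Q t) / t else 0) \<partial>lborel)"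
    using nonneg[OF Q_nonneg]
    by (intro nn_integral_cong)
       (auto simp: indicator_def exp_os_density_nonneg field_simps simp flip: ennreal_mult)
  also have "\<dots> = (\<integral>\<^sup>+t. ennreal (if 0 < t then u (Q t) / t else 0) \<partial>exp_os_moment_measure i n)"
    unfolding exp_os_moment_measure_def by (subst nn_integral_density) auto
  finally show ?thesis .
qed

lemma AE_order_stat_nonneg:
  assumes "1 \<le> i" "i \<le> n"
  shows "AE x in order_stat M i n. 0 \<le> x"
  unfolding order_stat_eq_distr_exp_os_law[OF assms]
  by (subst AE_distr_iff) (auto simp: exp_os_law_def Q_nonneg)

text \<open>Factor \<open>u (Q t) / t\<close> as \<open>(u (Q t) / Q t) * (Q t / t)\<close>, a
  product of nonnegative increasing factors. Where \<open>Q\<close> is 0 the value is 0 because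
  \<open>u 0 = 0\<close>.\<close>

lemma mono_star_shaped_comp_Q:
  assumes u: "star_shaped_fun u"
    and DHRA: "\<And>s t. 0 < s \<Longrightarrow> s \<le> t \<Longrightarrow> Q s / s \<le> Q t / t"
  shows "mono (\<lambda>t. if 0 < t then u (Q t) / t else 0)"
proof (rule monoI)
  fix s t :: real assume st: "s \<le> t"
  have u_nonneg: "0 \<le> u (Q t)" for t using u Q_nonneg by (auto simp: star_shaped_fun_def)
  show "(if 0 < s then u (Q s) / s else 0) \<le> (if 0 < t then u (Q t) / t else 0)"
  proof (cases "0 < s \<and> 0 < Q s")
    case True
    then have pos: "0 < s" "0 < t" "0 < Q s" "0 < Q t" "Q s \<le> Q t"
      using st monoD[OF mono_Q st] by auto
    have "u (Q s) / s = (u (Q s) / Q s) * (Q s / s)" using pos by simp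
    also have "\<dots> \<le> (u (Q t) / Q t) * (Q t / t)"
      using u pos DHRA[OF pos(1) st] u_nonneg by (intro mult_mono) (auto simp: star_shaped_fun_def)
    also have "\<dots> = u (Q t) / t" using pos by simp
    finally show ?thesis using pos by simp
  next
    case False
    then have "(if 0 < s then u (Q s) / s else 0) = 0"
      using u Q_nonneg[of s] by (auto simp: star_shaped_fun_def not_less)
    then show ?thesis using u_nonneg by simp
  qed
qed

lemma ss_ge_order_stat:
  assumes "1 \<le> i" "i \<le> n" "1 \<le> j" "j \<le> m"
    and DHRA: "\<And>s t. 0 < s \<Longrightarrow> s \<le> t \<Longrightarrow> Q s / s \<le> Q t / t"
    and le: "\<And>a. 0 \<le> a \<Longrightarrow> exp_os_moment j m a \<le> exp_os_moment i n a"
  shows "ss_ge (order_stat M i n) (order_stat M j m)"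
  unfolding ss_ge_def
proof (intro allI impI, elim conjE)
  fix u assume u: "star_shaped_fun u"
    and int: "integrable (order_stat M i n) u" "integrable (order_stat M j m) u"
  have u_nonneg: "0 \<le> u x" if "0 \<le> x" for x using u that by (auto simp: star_shaped_fun_def)
  have [measurable]: "u \<in> borel_measurable borel"
    using borel_measurable_integrable[OF int(1)] by (simp add: order_stat_def)
  \<comment> \<open>\<open>u\<close> is nonnegative only on the nonnegative half-line, so passing to
    the \<open>ennreal\<close> integral relies on the order statistic being almost surely
    nonnegative.\<close>
  have eq: "ennreal (\<integral>x. u x \<partial>order_stat M k l)
      = (\<integral>\<^sup>+t. ennreal (if 0 < t then u (Q t) / t else 0) \<partial>exp_os_moment_measure k l)"
    if "1 \<le> k" "k \<le> l" "integrable (order_stat M k l) u" for k l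
  proof -
    have "(\<integral>\<^sup>+x. ennreal (u x) \<partial>order_stat M k l) = ennreal (\<integral>x. u x \<partial>order_stat M k l)"
      using AE_order_stat_nonneg[OF that(1,2)] u_nonneg
      by (intro nn_integral_eq_integral that(3)) (auto elim: eventually_mono)
    then show ?thesis using nn_integral_order_stat[OF that(1,2) _ u_nonneg] by simp
  qed
  have "ennreal (\<integral>x. u x \<partial>order_stat M j m) \<le> ennreal (\<integral>x. u x \<partial>order_stat M i n)"
    unfolding eq[OF assms(1,2) int(1)] eq[OF assms(3,4) int(2)]
  proof (rule nn_integral_mono_tail_dominance)
    show "mono (\<lambda>t. if 0 < t then u (Q t) / t else 0)"
      using u DHRA by (rule mono_star_shaped_comp_Q)
  qed (use assms in \<open>auto simp: emeasure_exp_os_moment_measure sigma_finite_exp_os_moment_measure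
         exp_os_moment_measure_def[THEN arg_cong[where f=sets]] intro!: ennreal_leI\<close>)
  moreover have "0 \<le> (\<integral>x. u x \<partial>order_stat M i n)"
    using AE_order_stat_nonneg[OF assms(1,2)] u_nonneg
    by (intro integral_nonneg_AE) (auto elim: eventually_mono)
  ultimately show "(\<integral>x. u x \<partial>order_stat M j m) \<le> (\<integral>x. u x \<partial>order_stat M i n)"
    by simp
qed

end

theorem theorem16:
  fixes M :: "real measure" and i n j m :: nat
  assumes "real_distribution M"
    and "AE x in M. 0 \<le> x"
    and DHRA: "\<forall>x y. 0 < x \<and> x \<le> y \<longrightarrow>
          quantile (cdf M) (1 - exp (-x)) / x \<le> quantile (cdf M) (1 - exp (-y)) / y"
    and "1 \<le> i" "i \<le> n" "1 \<le> j" "j \<le> m"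
    and "\<forall>r \<in> {r. 0 < r \<and> r < 1 \<and>
             r powr (real i - real j) * (1 - r) powr ((real n - real i) - (real m - real j))
             = Beta (real i) (real n - real i + 1) / Beta (real j) (real m - real j + 1)}.
           0 \<le> Zfun i n j m (- ln (1 - r))"
  shows "ss_ge (order_stat M i n) (order_stat M j m)"
proof -
  interpret real_distribution M by fact
  interpret nonneg_distribution M by unfold_locales fact
  note ij = assms(4-7)
  \<comment> \<open>Substituting \<open>r = 1 - exp (-x)\<close> gives
    \<open>- ln (1 - r) = x\<close>.\<close>
  have crit: "0 \<le> Zfun i n j m x"
    if "0 < x" "exp_os_density i n x = exp_os_density j m x" for x
    using bspec[OF assms(8), of "1 - exp (-x)"] exp_os_density_eq_imp_root[OF ij that] that(1) by simp
  have Z: "0 \<le> Zfun i n j m x" if "0 < x" for x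
    using Zfun_nonneg[OF ij crit that] .
  \<comment> \<open>Roots \<open>r\<close> in (0,1) only reach \<open>x > 0\<close>, while the tail
    comparison starts at 0; the endpoint follows by continuity.\<close>
  have "0 \<le> Zfun i n j m 0"
  proof (rule tendsto_lowerbound)
    show "(Zfun i n j m \<longlongrightarrow> Zfun i n j m 0) (at_right 0)"
      using DERIV_isCont[OF Zfun_asymp(2)[OF ij, of 0]] by (auto simp: isCont_def intro: tendsto_within_subset)
    show "eventually (\<lambda>x. 0 \<le> Zfun i n j m x) (at_right 0)"
      using Z by (intro eventually_at_rightI[of 0 1]) auto
  qed simp
  then have "exp_os_moment j m a \<le> exp_os_moment i n a" if "0 \<le> a" for a
    using Z[of a] that by (cases "a = 0") (auto simp: Zfun_eq)
  moreover have "Q s / s \<le> Q t / t" if "0 < s" "s \<le> t" for s t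
    using DHRA that by (simp add: Q_def)
  ultimately show ?thesis using ij by (intro ss_ge_order_stat)
qed

end
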